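(* Let $\{x_k\}$ be generated by the SLiSeS algorithm with uniform sampling, as described in the context. Suppose that: (A1) the functions $f_1,\dots,f_N:\mathbb{R}^n\to\mathbb{R}$ are bounded from below and twice continuously differentiable with $L$-Lipschitz-continuous gradients; (A2) there is a constant $G>0$ such that $E[\|g_k-\nabla f(x_k)\|^2\mid\mathcal{F}_k]\le G$ for all $k$ that are multiples of $m$; (A3) there are constants $C,\theta>0$ and $0<\delta<1$ such that for every $k\ge1$ that is a multiple of $m$, $$P(B_k)\,E[\nabla f(x_k)^T\nabla f_{\mathcal{N}_k}(x_k)\mid\mathcal{F}_k,B_k]\le\frac{\theta}{s}\|\nabla f(x_k)\|^2+\frac{C}{s\,k^{\delta}},$$ where $B_k$ is the event $\nabla f(x_k)^T\nabla f_{\mathcal{N}_k}(x_k)\ge0$, $P(B_k)$ is its probability (conditional on $\mathcal{F}_k$), and $s$ is the number of possible subsamples. Then, provided that $s\ge\theta$, with probability 1, $$\liminf_{k\to\infty}\|\nabla f(x_k)\|=0.$$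
   Context: Problem: minimize $f(x)=\frac1N\sum_{i=1}^N f_i(x)$ over $x\in\mathbb{R}^n$. Let $\mathcal{N}=\{1,\dots,N\}$. For a subsample $\mathcal{N}_k\subseteq\mathcal{N}$ with $|\mathcal{N}_k|=S$, set $f_{\mathcal{N}_k}(x)=\frac1S\sum_{i\in\mathcal{N}_k}f_i(x)$ and $\nabla f_{\mathcal{N}_k}(x)=\frac1S\sum_{i\in\mathcal{N}_k}\nabla f_i(x)$. SLiSeS algorithm. Input: $x_0\in\mathbb{R}^n$, $\eta\in(0,1)$, $S\in\{1,\dots,N\}$, an integer $m\ge1$, constants $0<\gamma_{\min}\le1\le\gamma_{\max}<\infty$, nonnegative numbers $t_k$ with $\sum_k t_k\le\bar t<\infty$. For $k=0,1,2,\dots$: (S1) If $k$ is a multiple of $m$, choose (randomly) $\mathcal{N}_k\subseteq\mathcal{N}$ with $|\mathcal{N}_k|=S$; otherwise $\mathcal{N}_k=\mathcal{N}_{k-1}$. (S2) $g_k=\nabla f_{\mathcal{N}_k}(x_k)$. (S3) If $k$ is a multiple of $m$ and $m>1$, set $c_k=1/\|g_k\|$. Otherwise set $s_{k-1}=x_k-x_{k-1}$, $y_{k-1}=g_k-g_{k-1}$, $c_k=\|s_{k-1}\|^2/(s_{k-1}^Ty_{k-1})$. (If the formula for $c_k$ is undefined, put $c_k=1$.) (S4) $\gamma_k=\min\{\gamma_{\max},\max\{\gamma_{\min},c_k\}\}/\max\{k,1\}$. (S5) $d_k=-\gamma_k g_k$. (S6) Find $\alpha_k\in(0,1]$ with $f_{\mathcal{N}_k}(x_k+\alpha_kd_k)\le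 f_{\mathcal{N}_k}(x_k)+\eta\alpha_k d_k^T\nabla f_{\mathcal{N}_k}(x_k)+t_k$ by the procedure LSP below. (S7) $x_{k+1}=x_k+\alpha_kd_k$. LSP at iteration $k$: put $dm_k=g_k^Td_k$. Start with trial step $\alpha=1$ and repeat the following. If $f_{\mathcal{N}_k}(x_k+\alpha d_k)\le f_{\mathcal{N}_k}(x_k)+\eta\alpha\, dm_k+t_k$, stop with $\alpha_k=\alpha$. Otherwise: - if $\alpha>0.1$, compute $\tilde\alpha=\dfrac{-dm_k\,\alpha^2}{2\,(f_{\mathcal{N}_k}(x_k+\alpha d_k)-f_{\mathcal{N}_k}(x_k)-\alpha\, dm_k)}$; if $\tilde\alpha<0.1\alpha$ or $\tilde\alpha>0.9\alpha$, replace $\tilde\alpha$ by $\alpha/2$; then set $\alpha:=\tilde\alpha$; - if $\alpha\le0.1$, set $\alpha:=\alpha/2$. $\mathcal{F}_k$ is the $\sigma$-algebra generated by $\mathcal{N}_0,\dots,\mathcal{N}_{k-1}$. Uniform sampling: at each $k$ that is a multiple of $m$, conditionally on $\mathcal{F}_k$, $\mathcal{N}_k$ is uniformly distributed over the $s$ possible subsamples (the subsets of $\mathcal{N}$ of size $S$); in particular $E[f_{\mathcal{N}_k}(x_k)\mid\mathcal{F}_k]=f(x_k)$ and $E[g_k\mid\mathcal{F}_k]=\nabla f(x_k)$ for such $k$. The product $P(B_k)E[\,\cdot\mid\mathcal{F}_k,B_k]$ is read as $0$ if $P(B_k)=0$. *)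

theory Defs
  imports "HOL-Probability.Probability" "HOL-Library.While_Combinator"
begin

definition grad :: "('a::real_inner \<Rightarrow> real) \<Rightarrow> 'a \<Rightarrow> 'a" where
  "grad f x = (THE D. GDERIV f x :> D)"

definition twice_continuously_differentiable :: "(real ^ 'n \<Rightarrow> real) \<Rightarrow> bool" where
  "twice_continuously_differentiable f \<longleftrightarrow>
     (\<exists>(Df :: real ^ 'n \<Rightarrow> real ^ 'n) (D2f :: real ^ 'n \<Rightarrow> real ^ 'n ^ 'n).
        (\<forall>x. GDERIV f x :> Df x) \<and>
        (\<forall>x. (Df has_derivative (\<lambda>h. D2f x *v h)) (at x)) \<and>
        continuous_on UNIV D2f)"

(* With A = {1..N} this is the full objective; for a subsample A of size S the divisor is S. *)
definition avg_obj :: "(nat \<Rightarrow> 'a \<Rightarrow> real) \<Rightarrow> nat set \<Rightarrow> 'a \<Rightarrow> real" where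
  "avg_obj f A x = (1 / real (card A)) * (\<Sum>i\<in>A. f i x)"

definition avg_grad :: "(nat \<Rightarrow> 'a::real_inner \<Rightarrow> real) \<Rightarrow> nat set \<Rightarrow> 'a \<Rightarrow> 'a" where
  "avg_grad f A x = (1 / real (card A)) *\<^sub>R (\<Sum>i\<in>A. grad (f i) x)"

definition subsamples :: "nat \<Rightarrow> nat \<Rightarrow> nat set set" where
  "subsamples N S = {A. A \<subseteq> {1..N} \<and> card A = S}"

definition lsp_accept ::
  "('a::real_inner \<Rightarrow> real) \<Rightarrow> 'a \<Rightarrow> 'a \<Rightarrow> real \<Rightarrow> real \<Rightarrow> real \<Rightarrow> real \<Rightarrow> bool" where
  "lsp_accept F x d dm \<eta> t \<alpha> \<longleftrightarrow> F (x + \<alpha> *\<^sub>R d) \<le> F x + \<eta> * \<alpha> * dm + t"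

definition lsp_next ::
  "('a::real_inner \<Rightarrow> real) \<Rightarrow> 'a \<Rightarrow> 'a \<Rightarrow> real \<Rightarrow> real \<Rightarrow> real" where
  "lsp_next F x d dm \<alpha> =
     (if \<alpha> > 1 / 10 then
        (let \<alpha>' = (- dm * \<alpha>\<^sup>2) / (2 * (F (x + \<alpha> *\<^sub>R d) - F x - \<alpha> * dm))
         in if \<alpha>' < (1 / 10) * \<alpha> \<or> \<alpha>' > (9 / 10) * \<alpha> then \<alpha> / 2 else \<alpha>')
      else \<alpha> / 2)"

(* If the loop did not terminate, while would return an unspecified value; termination is not
   built into the definition. *)
definition lsp ::
  "('a::real_inner \<Rightarrow> real) \<Rightarrow> 'a \<Rightarrow> 'a \<Rightarrow> real \<Rightarrow> real \<Rightarrow> real \<Rightarrow> real" where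
  "lsp F x d dm \<eta> t = while (\<lambda>\<alpha>. \<not> lsp_accept F x d dm \<eta> t \<alpha>) (lsp_next F x d dm) 1"

(* The first argument of slises_coeff is m and the second is k. The value is 1 where the formula
   is undefined: vanishing gradient, vanishing inner product, or no previous iterate (m = 1, k = 0). *)
definition slises_coeff ::
  "nat \<Rightarrow> nat \<Rightarrow> (nat \<Rightarrow> 'a::real_inner) \<Rightarrow> (nat \<Rightarrow> 'a) \<Rightarrow> real" where
  "slises_coeff m k x g =
     (if m dvd k \<and> m > 1 then (if g k = 0 then 1 else 1 / norm (g k))
      else if k = 0 then 1
      else (let s = x k - x (k - 1); y = g k - g (k - 1)
            in if s \<bullet> y = 0 then 1 else (norm s)\<^sup>2 / (s \<bullet> y)))"

(* One realisation of the algorithm; NN is the sequence of subsamples. *)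
definition slises_run ::
  "(nat \<Rightarrow> 'a::real_inner \<Rightarrow> real) \<Rightarrow> nat \<Rightarrow> nat \<Rightarrow> nat \<Rightarrow> real \<Rightarrow> real \<Rightarrow> real \<Rightarrow> (nat \<Rightarrow> real) \<Rightarrow> 'a \<Rightarrow>
   (nat \<Rightarrow> nat set) \<Rightarrow> (nat \<Rightarrow> 'a) \<Rightarrow> (nat \<Rightarrow> 'a) \<Rightarrow> (nat \<Rightarrow> real) \<Rightarrow> (nat \<Rightarrow> real) \<Rightarrow> (nat \<Rightarrow> 'a) \<Rightarrow>
   (nat \<Rightarrow> real) \<Rightarrow> bool" where
  "slises_run f N S m \<eta> \<gamma>min \<gamma>max t x0 NN x g c \<gamma> d \<alpha> \<longleftrightarrow>
     x 0 = x0 \<and>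
     (\<forall>k. (if m dvd k then NN k \<in> subsamples N S else NN k = NN (k - 1)) \<and>
          g k = avg_grad f (NN k) (x k) \<and>
          c k = slises_coeff m k x g \<and>
          \<gamma> k = min \<gamma>max (max \<gamma>min (c k)) / real (max k 1) \<and>
          d k = - (\<gamma> k *\<^sub>R g k) \<and>
          \<alpha> k = lsp (avg_obj f (NN k)) (x k) (d k) (g k \<bullet> d k) \<eta> (t k) \<and>
          x (Suc k) = x k + \<alpha> k *\<^sub>R d k)"

(* The sigma-algebra generated by NN 0, ..., NN (k - 1); on the (finite) range of the subsamples
   it suffices to take preimages of singletons as generators. *)
definition past_algebra :: "'w measure \<Rightarrow> (nat \<Rightarrow> 'w \<Rightarrow> nat set) \<Rightarrow> nat \<Rightarrow> 'w measure" where
  "past_algebra M NN k = sigma (space M) {NN j -` {A} \<inter> space M | j A. j < k}"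

definition cprob :: "'w measure \<Rightarrow> 'w measure \<Rightarrow> 'w set \<Rightarrow> 'w \<Rightarrow> real" where
  "cprob M F B = real_cond_exp M F (indicator B)"

(* Conditional expectation of X given the sigma-algebra F and the event B; it is 0 where
   cprob M F B vanishes. *)
definition cexp_event :: "'w measure \<Rightarrow> 'w measure \<Rightarrow> ('w \<Rightarrow> real) \<Rightarrow> 'w set \<Rightarrow> 'w \<Rightarrow> real" where
  "cexp_event M F X B w = real_cond_exp M F (\<lambda>v. X v * indicator B v) w / cprob M F B w"

definition uniform_sampling ::
  "'w measure \<Rightarrow> nat \<Rightarrow> nat \<Rightarrow> nat \<Rightarrow> (nat \<Rightarrow> 'w \<Rightarrow> nat set) \<Rightarrow> bool" where
  "uniform_sampling M N S m NN \<longleftrightarrow>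
     (\<forall>k. m dvd k \<longrightarrow> (\<forall>A\<in>subsamples N S. AE w in M.
        cprob M (past_algebra M NN k) {v \<in> space M. NN k v = A} w
          = 1 / real (card (subsamples N S))))"

end

theory Submission
  imports Defs
begin

text \<open>The idea is to follow the full objective from one resampling index \<open>k\<close>, a multiple of \<open>m\<close>, to the
  next one, and to take plain expectations over such a cycle.

  Since the steps satisfy \<open>\<gamma> \<le> \<gamma>max / k\<close>, the descent inequality for functions with Lipschitz gradient
  shows that the line search accepts the first trial step as soon as \<open>k\<close> is large
  (\<open>lsp_full_step\<close>). From then on the algorithm is a gradient iteration with steps of order \<open>1 / k\<close>,
  and within one cycle all the steps use the same subsample. Hence the gradients met during the cycle
  differ from the first one, \<open>g\<close>, by a relative error \<open>O(1 / k)\<close>, and the cycle moves the iterate by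
  \<open>- \<Gamma> g + O(\<parallel>g\<parallel> / k\<^sup>2)\<close>, where \<open>\<Gamma>\<close> is the total step. Writing \<open>H\<close> for the full gradient at the
  start of the cycle and \<open>X\<close> for the inner product of \<open>H\<close> and \<open>g\<close>, the objective changes by at most
  \<open>- \<Gamma> X + O((\<parallel>H\<parallel>\<^sup>2 + \<parallel>g\<parallel>\<^sup>2) / k\<^sup>2)\<close>.

  The difficulty is that \<open>\<Gamma>\<close> depends on the subsample just as \<open>g\<close> does, so that the mean of \<open>\<Gamma> X\<close> is
  not controlled by the mean of \<open>X\<close>. However \<open>\<gamma>min r \<le> \<Gamma> \<le> \<gamma>max r\<close> with the deterministic number
  \<open>r = 1/k + \<dots> + 1/(k+m-1)\<close>, and so
  \<open>- \<Gamma> X \<le> - \<gamma>max r X + (\<gamma>max - \<gamma>min) r max 0 X\<close>. Uniform sampling makes the mean of \<open>X\<close> equal to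
  that of \<open>\<parallel>H\<parallel>\<^sup>2\<close>, and the hypothesis on the event \<open>X \<ge> 0\<close> bounds the mean of \<open>max 0 X\<close> by
  \<open>\<theta>/s\<close> times the same number, up to \<open>C / (s k powr \<delta>)\<close>. As \<open>\<theta> \<le> s\<close>, the mean decrease is at least
  \<open>\<gamma>min r\<close> times the mean of \<open>\<parallel>H\<parallel>\<^sup>2\<close>, up to an error of order \<open>k powr -(1+\<delta>)\<close> and the remainder
  \<open>O((\<parallel>H\<parallel>\<^sup>2 + \<parallel>g\<parallel>\<^sup>2) / k\<^sup>2)\<close>. By the variance bound the mean of \<open>\<parallel>g\<parallel>\<^sup>2\<close> is at most \<open>2 G\<close> plus twice
  the mean of \<open>\<parallel>H\<parallel>\<^sup>2\<close>, so that for large \<open>k\<close> half of the decrease absorbs the remainder except for a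
  multiple of \<open>1 / k\<^sup>2\<close>.

  What is left of the errors is summable over the cycles and the objective is bounded below, so the series of the
  means of \<open>\<parallel>H\<parallel>\<^sup>2 / j\<close>, over the cycles \<open>k = j m\<close>, converges (\<open>summable_cycle_recursion\<close>). By
  monotone convergence \<open>\<parallel>H\<parallel>\<^sup>2 / j\<close> is almost surely summable, which is compatible with the divergence
  of the harmonic series only if \<open>\<parallel>H\<parallel>\<close> comes arbitrarily close to \<open>0\<close> infinitely often.

  Measurability and integrability come for free: only finitely many histories of subsamples are
  possible, and the iterates are functions of the history (\<open>slises_run_determined\<close>).\<close>

section \<open>Gradients of averages and the descent inequality\<close>

lemma GDERIV_grad_eq:
  assumes "GDERIV F x :> D"
  shows "grad F x = D"
proof -
  have "D' = D" if "GDERIV F x :> D'" for D'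
  proof -
    have "(\<lambda>h. h \<bullet> D') = (\<lambda>h. h \<bullet> D)"
      using assms that unfolding gderiv_def by (rule has_derivative_unique[symmetric])
    then show ?thesis
      by (metis vector_eq_ldot)
  qed
  then show ?thesis
    unfolding grad_def using assms by blast
qed

lemma twice_continuously_differentiable_GDERIV:
  assumes "twice_continuously_differentiable F"
  shows "GDERIV F x :> grad F x"
  using assms GDERIV_grad_eq unfolding twice_continuously_differentiable_def by metis

lemma GDERIV_avg_obj:
  assumes "\<And>i. i \<in> A \<Longrightarrow> GDERIV (f i) x :> grad (f i) x"
  shows "GDERIV (avg_obj f A) x :> avg_grad f A x"
proof -
  have "((\<lambda>y. (1 / real (card A)) * (\<Sum>i\<in>A. f i y)) has_derivative
      (\<lambda>h. (1 / real (card A)) * (\<Sum>i\<in>A. h \<bullet> grad (f i) x))) (at x)"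
    using assms unfolding gderiv_def by (intro has_derivative_mult_right has_derivative_sum) auto
  then show ?thesis
    unfolding gderiv_def avg_obj_def[abs_def] avg_grad_def by (simp add: inner_sum_right)
qed

lemma avg_grad_lipschitz:
  assumes "finite A" "A \<noteq> {}"
    and "\<And>i. i \<in> A \<Longrightarrow> L-lipschitz_on UNIV (grad (f i))"
  shows "norm (avg_grad f A x - avg_grad f A y) \<le> L * norm (x - y)"
proof -
  have "norm (avg_grad f A x - avg_grad f A y)
      = (1 / real (card A)) * norm (\<Sum>i\<in>A. grad (f i) x - grad (f i) y)"
    by (simp add: avg_grad_def sum_subtractf flip: scaleR_right_diff_distrib)
  also have "\<dots> \<le> (1 / real (card A)) * (\<Sum>i\<in>A. L * norm (x - y))"
    using assms(3) by (intro mult_left_mono sum_norm_le) (auto simp: lipschitz_on_def dist_norm)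
  also have "\<dots> = L * norm (x - y)"
    using assms(1,2) by simp
  finally show ?thesis .
qed

text \<open>The difference of the two sides at \<open>y + \<tau> v\<close> has a nonpositive derivative in \<open>\<tau> \<in> [0, 1]\<close>, by the
  Cauchy-Schwarz inequality and the Lipschitz bound.\<close>
lemma descent_inequality:
  fixes F :: "'a::real_inner \<Rightarrow> real"
  assumes F: "\<And>y. GDERIV F y :> h y"
    and h: "\<And>y z. norm (h y - h z) \<le> L * norm (y - z)"
  shows "F (y + v) \<le> F y + h y \<bullet> v + L / 2 * (norm v)\<^sup>2"
proof -
  define \<phi> where "\<phi> \<tau> = F (y + \<tau> *\<^sub>R v) - \<tau> * (h y \<bullet> v) - L / 2 * \<tau>\<^sup>2 * (norm v)\<^sup>2" for \<tau>
  have "\<phi> 1 \<le> \<phi> 0"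
  proof (rule DERIV_nonpos_imp_nonincreasing[where f = \<phi>])
    fix \<tau> :: real assume \<tau>: "0 \<le> \<tau>" "\<tau> \<le> 1"
    let ?D = "h (y + \<tau> *\<^sub>R v) \<bullet> v - h y \<bullet> v - L * \<tau> * (norm v)\<^sup>2"
    have "((\<lambda>\<tau>. F (y + \<tau> *\<^sub>R v)) has_derivative (\<lambda>\<epsilon>. (\<epsilon> *\<^sub>R v) \<bullet> h (y + \<tau> *\<^sub>R v))) (at \<tau>)"
      by (rule has_derivative_compose[where g = F])
         (use F in \<open>auto simp: gderiv_def intro!: derivative_eq_intros\<close>)
    then have "((\<lambda>\<tau>. F (y + \<tau> *\<^sub>R v)) has_real_derivative h (y + \<tau> *\<^sub>R v) \<bullet> v) (at \<tau>)"
      unfolding has_field_derivative_def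
      by (rule has_derivative_eq_rhs) (auto simp: inner_commute mult.commute)
    then have "(\<phi> has_real_derivative ?D) (at \<tau>)"
      unfolding \<phi>_def[abs_def] by (auto intro!: derivative_eq_intros)
    moreover have "h (y + \<tau> *\<^sub>R v) \<bullet> v - h y \<bullet> v \<le> norm (h (y + \<tau> *\<^sub>R v) - h y) * norm v"
      by (metis inner_diff_left norm_cauchy_schwarz)
    moreover have "\<dots> \<le> (L * norm (y + \<tau> *\<^sub>R v - y)) * norm v"
      by (intro mult_right_mono h) auto
    ultimately show "\<exists>D. (\<phi> has_real_derivative D) (at \<tau>) \<and> D \<le> 0"
      using \<tau> by (intro exI[of _ ?D]) (auto simp: power2_eq_square)
  qed simp
  then show ?thesis
    by (simp add: \<phi>_def)
qed

lemma avg_obj_bounded_below: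
  assumes "\<And>i. i \<in> A \<Longrightarrow> bdd_below (range (f i))"
  shows "\<exists>l. \<forall>x. l \<le> avg_obj f A x"
proof -
  have "\<exists>l. \<forall>x. l \<le> f i x" if "i \<in> A" for i
    using assms[OF that] unfolding bdd_below_def by auto
  then obtain l where "\<And>i x. i \<in> A \<Longrightarrow> l i \<le> f i x"
    by metis
  then have "(1 / real (card A)) * (\<Sum>i\<in>A. l i) \<le> avg_obj f A x" for x
    unfolding avg_obj_def by (intro mult_left_mono sum_mono) auto
  then show ?thesis by blast
qed

section \<open>Averaging over the subsamples\<close>

lemma finite_subsamples: "finite (subsamples N S)"
  unfolding subsamples_def by (rule finite_subset[of _ "Pow {1..N}"]) auto

lemma card_subsamples: "card (subsamples N S) = N choose S"
  using n_subsets[of "{1..N}" S] by (simp add: subsamples_def)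

text \<open>The subsamples that miss \<open>i\<close> are the subsets of size \<open>S\<close> of an \<open>(N - 1)\<close>-element set, and Pascal's rule
  gives the rest.\<close>
lemma card_subsamples_containing:
  assumes "S \<ge> 1" "i \<in> {1..N}"
  shows "card {A \<in> subsamples N S. i \<in> A} = (N - 1) choose (S - 1)"
proof -
  have "{A \<in> subsamples N S. i \<notin> A} = {A. A \<subseteq> {1..N} - {i} \<and> card A = S}"
    by (auto simp: subsamples_def)
  then have "card {A \<in> subsamples N S. i \<notin> A} = (N - 1) choose S"
    using n_subsets[of "{1..N} - {i}" S] assms by simp
  moreover have "card (subsamples N S)
      = card {A \<in> subsamples N S. i \<in> A} + card {A \<in> subsamples N S. i \<notin> A}"
    by (subst card_Un_disjoint[symmetric]) (auto simp: finite_subsamples intro: arg_cong[where f = card])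
  moreover have "N choose S = ((N - 1) choose (S - 1)) + ((N - 1) choose S)"
    using assms by (intro choose_reduce_nat) auto
  ultimately show ?thesis
    by (simp add: card_subsamples)
qed

text \<open>Unbiasedness of the subsampled gradient. Exchanging the two sums counts each index \<open>i\<close> once for every
  subsample that contains it, and \<open>S (N choose S) = N (N - 1 choose S - 1)\<close> turns the resulting factor
  into \<open>1 / N\<close>.\<close>
lemma mean_avg_grad_subsamples:
  assumes "S \<in> {1..N}"
  shows "(1 / real (card (subsamples N S))) *\<^sub>R (\<Sum>A\<in>subsamples N S. avg_grad f A x)
    = avg_grad f {1..N} x"
proof -
  let ?v = "\<lambda>i. grad (f i) x"
  have "(\<Sum>A\<in>subsamples N S. avg_grad f A x)
      = (1 / real S) *\<^sub>R (\<Sum>A\<in>subsamples N S. \<Sum>i | i \<in> {1..N} \<and> i \<in> A. ?v i)"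
    by (auto simp: scaleR_right.sum avg_grad_def subsamples_def
          intro!: sum.cong arg_cong2[where f = "(*\<^sub>R)"])
  also have "(\<Sum>A\<in>subsamples N S. \<Sum>i | i \<in> {1..N} \<and> i \<in> A. ?v i)
      = (\<Sum>i\<in>{1..N}. \<Sum>A | A \<in> subsamples N S \<and> i \<in> A. ?v i)"
    by (rule sum.swap_restrict) (auto simp: finite_subsamples)
  also have "\<dots> = (\<Sum>i\<in>{1..N}. real ((N - 1) choose (S - 1)) *\<^sub>R ?v i)"
    using assms by (intro sum.cong) (auto simp: sum_constant_scaleR card_subsamples_containing)
  finally have "(\<Sum>A\<in>subsamples N S. avg_grad f A x)
      = (real ((N - 1) choose (S - 1)) / real S) *\<^sub>R (\<Sum>i\<in>{1..N}. ?v i)"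
    by (simp flip: scaleR_right.sum)
  moreover have "real S * real (N choose S) = real N * real ((N - 1) choose (S - 1))"
    using times_binomial_minus1_eq[of S N] assms by (metis atLeastAtMost_iff less_eq_Suc_le One_nat_def of_nat_mult)
  moreover have "N choose S > 0" "S > 0" "N > 0"
    using assms by (auto simp: zero_less_binomial_iff)
  ultimately show ?thesis
    by (simp add: card_subsamples avg_grad_def field_simps)
qed

section \<open>One cycle of the algorithm\<close>

text \<open>The loop stops at its first trial: if \<open>L \<gamma> / 2 \<le> 1 - \<eta>\<close>, then the second-order term
  \<open>L \<gamma>\<^sup>2 \<parallel>h y\<parallel>\<^sup>2 / 2\<close> of the descent inequality eats up at most the share \<open>1 - \<eta>\<close> of the
  first-order decrease \<open>\<gamma> \<parallel>h y\<parallel>\<^sup>2\<close>.\<close>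
lemma lsp_full_step:
  fixes F :: "'a::real_inner \<Rightarrow> real"
  assumes F: "\<And>y. GDERIV F y :> h y"
    and h: "\<And>y z. norm (h y - h z) \<le> L * norm (y - z)"
    and "\<gamma> \<ge> 0" "L * \<gamma> \<le> 2 * (1 - \<eta>)" "t \<ge> 0"
  shows "lsp F y (- (\<gamma> *\<^sub>R h y)) (h y \<bullet> - (\<gamma> *\<^sub>R h y)) \<eta> t = 1"
proof -
  let ?n = "(norm (h y))\<^sup>2"
  have "F (y + - (\<gamma> *\<^sub>R h y)) \<le> F y + h y \<bullet> - (\<gamma> *\<^sub>R h y) + L / 2 * (norm (- (\<gamma> *\<^sub>R h y)))\<^sup>2"
    by (rule descent_inequality[OF F h])
  also have "\<dots> = F y - \<gamma> * ?n + (L * \<gamma>) * (\<gamma> * ?n) / 2"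
    by (simp add: power_mult_distrib dot_square_norm power2_eq_square[of \<gamma>])
  also have "\<dots> \<le> F y - \<gamma> * ?n + (2 * (1 - \<eta>)) * (\<gamma> * ?n) / 2"
    using assms(3,4) by (intro add_left_mono divide_right_mono mult_right_mono) auto
  also have "\<dots> = F y - \<eta> * \<gamma> * ?n"
    by (simp add: field_simps)
  finally have "lsp_accept F y (- (\<gamma> *\<^sub>R h y)) (h y \<bullet> - (\<gamma> *\<^sub>R h y)) \<eta> t 1"
    using assms(5) by (simp add: lsp_accept_def power2_norm_eq_inner)
  then show ?thesis
    unfolding lsp_def by (subst while_unfold) simp
qed

text \<open>A step of length at most \<open>b\<close> enlarges the gradient by a factor of at most \<open>1 + L b\<close>. All the gradients
  are therefore of the order of the first one, the iterates stay within \<open>R\<close> of the start, and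
  replacing each gradient by the first one costs at most \<open>L R\<close> per unit of step.\<close>
lemma gradient_steps_drift:
  fixes z :: "nat \<Rightarrow> 'a::real_inner"
  assumes h: "\<And>y z. norm (h y - h z) \<le> L * norm (y - z)"
    and step: "\<And>i. i < m \<Longrightarrow> z (Suc i) = z i - \<beta> i *\<^sub>R h (z i)"
    and \<beta>: "\<And>i. i < m \<Longrightarrow> 0 \<le> \<beta> i \<and> \<beta> i \<le> b"
    and "L \<ge> 0" "b \<ge> 0"
  defines "R \<equiv> real m * b * (1 + L * b) ^ m * norm (h (z 0))"
  shows "norm (z m - z 0) \<le> R"
    and "norm (z m - z 0 + (\<Sum>i<m. \<beta> i) *\<^sub>R h (z 0)) \<le> L * (real m * b) * R"
proof -
  have Lb: "L * b \<ge> 0"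
    using assms by simp
  have growth: "norm (h (z i)) \<le> (1 + L * b) ^ i * norm (h (z 0))" if "i \<le> m" for i
    using that
  proof (induction i)
    case (Suc i)
    have "norm (h (z (Suc i))) \<le> norm (h (z i)) + norm (h (z (Suc i)) - h (z i))"
      by (metis add.commute diff_add_cancel norm_triangle_ineq)
    also have "\<dots> \<le> norm (h (z i)) + L * norm (z (Suc i) - z i)"
      using h by simp
    also have "norm (z (Suc i) - z i) = \<beta> i * norm (h (z i))"
      using step[of i] \<beta>[of i] Suc.prems by simp
    also have "norm (h (z i)) + L * (\<beta> i * norm (h (z i))) \<le> norm (h (z i)) + L * (b * norm (h (z i)))"
      using \<beta>[of i] Suc.prems \<open>L \<ge> 0\<close> by (intro add_left_mono mult_left_mono mult_right_mono) auto
    also have "\<dots> = (1 + L * b) * norm (h (z i))"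
      by (simp add: algebra_simps)
    also have "\<dots> \<le> (1 + L * b) * ((1 + L * b) ^ i * norm (h (z 0)))"
      using Suc Lb by (intro mult_left_mono) auto
    finally show ?case
      by (simp add: algebra_simps)
  qed simp
  define q where "q = b * (1 + L * b) ^ m * norm (h (z 0))"
  have R: "R = real m * q"
    by (simp add: R_def q_def)
  have "q \<ge> 0"
    using Lb \<open>b \<ge> 0\<close> by (simp add: q_def)
  have inc: "norm (\<beta> i *\<^sub>R h (z i)) \<le> q" if "i < m" for i
  proof -
    have "(1 + L * b) ^ i * norm (h (z 0)) \<le> (1 + L * b) ^ m * norm (h (z 0))"
      using that Lb by (intro mult_right_mono power_increasing) auto
    then have "norm (h (z i)) \<le> (1 + L * b) ^ m * norm (h (z 0))"
      using growth[of i] that by simp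
    then have "\<beta> i * norm (h (z i)) \<le> b * ((1 + L * b) ^ m * norm (h (z 0)))"
      using \<beta>[OF that] \<open>b \<ge> 0\<close> by (intro mult_mono) auto
    then show ?thesis
      using \<beta>[OF that] by (simp add: q_def mult.assoc)
  qed
  have telescope: "z i - z 0 = - (\<Sum>j<i. \<beta> j *\<^sub>R h (z j))" if "i \<le> m" for i
    using that
  proof (induction i)
    case (Suc i)
    then have "z (Suc i) - z 0 = (z i - z 0) - \<beta> i *\<^sub>R h (z i)"
      using step[of i] by simp
    then show ?case
      using Suc by simp
  qed simp
  have drift: "norm (z i - z 0) \<le> R" if "i \<le> m" for i
  proof -
    have "norm (z i - z 0) \<le> (\<Sum>j<i. q)"
      unfolding telescope[OF that] norm_minus_cancel using inc that by (intro sum_norm_le) auto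
    also have "\<dots> \<le> R"
      using that \<open>q \<ge> 0\<close> by (simp add: R mult_right_mono)
    finally show ?thesis .
  qed
  show "norm (z m - z 0) \<le> R"
    by (rule drift) simp
  have "z m - z 0 + (\<Sum>i<m. \<beta> i) *\<^sub>R h (z 0) = (\<Sum>i<m. \<beta> i *\<^sub>R (h (z 0) - h (z i)))"
    by (simp add: telescope scaleR_sum_left scaleR_diff_right sum_subtractf)
  also have "norm \<dots> \<le> (\<Sum>i<m. b * (L * R))"
  proof (rule sum_norm_le)
    fix i assume "i \<in> {..<m}"
    then have i: "i < m" by simp
    have "norm (h (z 0) - h (z i)) \<le> L * R"
      using h[of "z 0" "z i"] drift[of i] i \<open>L \<ge> 0\<close>
      by (metis less_imp_le mult_left_mono norm_minus_commute order_trans)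
    then show "norm (\<beta> i *\<^sub>R (h (z 0) - h (z i))) \<le> b * (L * R)"
      using \<beta>[OF i] \<open>b \<ge> 0\<close> by (simp add: mult_mono)
  qed
  finally show "norm (z m - z 0 + (\<Sum>i<m. \<beta> i) *\<^sub>R h (z 0)) \<le> L * (real m * b) * R"
    by (simp add: mult_ac)
qed

text \<open>Here \<open>H\<close> is the gradient of the function to be decreased, while the steps follow another gradient \<open>h\<close>.
  The total step \<open>\<Gamma>\<close> enters the bound only through the limits \<open>lo\<close> and \<open>hi\<close>: the right-hand side keeps
  no product of \<open>\<Gamma>\<close> and \<open>X\<close>, which in the application are dependent random variables. The bound
  \<open>b\<^sub>1\<close> serves to have a constant in front of \<open>b\<^sup>2\<close> that is the same for all cycles.\<close>
lemma gradient_steps_descent: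
  fixes F :: "'a::real_inner \<Rightarrow> real"
  assumes F: "\<And>y. GDERIV F y :> H y"
    and H: "\<And>y z. norm (H y - H z) \<le> L * norm (y - z)"
    and h: "\<And>y z. norm (h y - h z) \<le> L * norm (y - z)"
    and step: "\<And>i. i < m \<Longrightarrow> z (Suc i) = z i - \<beta> i *\<^sub>R h (z i)"
    and \<beta>: "\<And>i. i < m \<Longrightarrow> 0 \<le> \<beta> i \<and> \<beta> i \<le> b"
    and "L \<ge> 0" "b \<ge> 0" "b \<le> b\<^sub>1"
    and total: "lo \<le> (\<Sum>i<m. \<beta> i)" "(\<Sum>i<m. \<beta> i) \<le> hi"
  defines "X \<equiv> H (z 0) \<bullet> h (z 0)"
  shows "F (z m) \<le> F (z 0) - hi * X + (hi - lo) * max 0 X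
    + L * (real m * (1 + L * b\<^sub>1) ^ m)\<^sup>2 * b\<^sup>2 * ((norm (H (z 0)))\<^sup>2 + (norm (h (z 0)))\<^sup>2)"
proof -
  define \<Gamma> where "\<Gamma> = (\<Sum>i<m. \<beta> i)"
  define e where "e = z m - z 0 + \<Gamma> *\<^sub>R h (z 0)"
  define u where "u = norm (H (z 0))"
  define v where "v = norm (h (z 0))"
  define q where "q = real m * (1 + L * b\<^sub>1) ^ m * b"
  define p where "p = (1 + L * b\<^sub>1) ^ m"
  have "p \<ge> 1"
    unfolding p_def using assms by (intro one_le_power) auto
  have R: "real m * b * (1 + L * b) ^ m * v \<le> q * v"
    unfolding q_def v_def using assms
    by (subst mult.assoc, subst mult.assoc, subst mult.commute[of b])
       (auto intro!: mult_mono power_mono)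
  have zm: "norm (z m - z 0) \<le> q * v"
    using gradient_steps_drift(1)[where h = h and z = z and m = m, OF h step \<beta> \<open>L \<ge> 0\<close> \<open>b \<ge> 0\<close>] R unfolding v_def by linarith
  have "real m * b \<le> q"
    unfolding q_def using \<open>p \<ge> 1\<close> \<open>b \<ge> 0\<close> unfolding p_def
    by (intro mult_right_mono) (auto simp: mult_le_cancel_left1)
  have "q \<ge> 0" "v \<ge> 0" "u \<ge> 0"
    using assms by (auto simp: q_def v_def u_def)
  have "norm e \<le> L * (real m * b) * (real m * b * (1 + L * b) ^ m * v)"
    using gradient_steps_drift(2)[where h = h and z = z and m = m, OF h step \<beta> \<open>L \<ge> 0\<close> \<open>b \<ge> 0\<close>] unfolding e_def \<Gamma>_def v_def .
  also have "\<dots> \<le> L * q * (q * v)"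
    using \<open>real m * b \<le> q\<close> \<open>q \<ge> 0\<close> \<open>v \<ge> 0\<close> \<open>L \<ge> 0\<close> \<open>b \<ge> 0\<close>
    by (intro mult_mono[OF mult_left_mono R]) (auto intro!: mult_nonneg_nonneg)
  finally have e: "norm e \<le> L * q * (q * v)" .
  have "F (z m) \<le> F (z 0) + H (z 0) \<bullet> (z m - z 0) + L / 2 * (norm (z m - z 0))\<^sup>2"
    using descent_inequality[OF F H, of "z 0" "z m - z 0"] by simp
  also have "H (z 0) \<bullet> (z m - z 0) = H (z 0) \<bullet> e - \<Gamma> * X"
    by (simp add: e_def X_def inner_add_right inner_diff_right)
  also have "H (z 0) \<bullet> e \<le> u * (L * q * (q * v))"
    unfolding u_def by (rule order_trans[OF norm_cauchy_schwarz mult_left_mono[OF e]]) simp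
  also have "u * (L * q * (q * v)) = L * q\<^sup>2 * (u * v)"
    by (simp add: power2_eq_square)
  also have "\<dots> \<le> L * q\<^sup>2 * ((u\<^sup>2 + v\<^sup>2) / 2)"
    using sum_squares_bound[of u v] \<open>L \<ge> 0\<close> by (intro mult_left_mono) auto
  also have "L / 2 * (norm (z m - z 0))\<^sup>2 \<le> L / 2 * (q * v)\<^sup>2"
    using zm \<open>L \<ge> 0\<close> by (intro mult_left_mono power_mono) auto
  also have "\<dots> = L * q\<^sup>2 * (v\<^sup>2 / 2)"
    by (simp add: power_mult_distrib)
  also have "\<dots> \<le> L * q\<^sup>2 * ((u\<^sup>2 + v\<^sup>2) / 2)"
    using \<open>L \<ge> 0\<close> by (intro mult_left_mono) auto
  finally have *: "F (z m) \<le> F (z 0) - \<Gamma> * X + L * q\<^sup>2 * (u\<^sup>2 + v\<^sup>2)"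
    by (simp add: algebra_simps)
  \<comment> \<open>With equality for the total step \<open>lo\<close> if \<open>X \<ge> 0\<close>, and for the total step \<open>hi\<close> otherwise.\<close>
  have "- \<Gamma> * X \<le> - hi * X + (hi - lo) * max 0 X"
  proof (cases "X \<ge> 0")
    case True
    then have "lo * X \<le> \<Gamma> * X"
      using total(1) unfolding \<Gamma>_def by (intro mult_right_mono)
    then show ?thesis
      using True by (simp add: algebra_simps)
  next
    case False
    then have "hi * X \<le> \<Gamma> * X"
      using total(2) unfolding \<Gamma>_def by (intro mult_right_mono_neg) auto
    then show ?thesis
      using False by simp
  qed
  with * show ?thesis
    by (simp add: q_def u_def v_def power_mult_distrib mult_ac)
qed

text \<open>The lower bound on \<open>k\<close> makes the line search accept full steps throughout the cycle. The step lengths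
  enter only through the clipping to \<open>[\<gamma>min, \<gamma>max]\<close>, whatever the value of the spectral coefficient.\<close>
lemma slises_run_cycle_descent:
  fixes f :: "nat \<Rightarrow> 'a::real_inner \<Rightarrow> real"
  assumes run: "slises_run f N S m \<eta> \<gamma>min \<gamma>max t x0 NN x g c \<gamma> d \<alpha>"
    and S: "S \<in> {1..N}" and "m dvd k" "k \<ge> 1" "m \<ge> 1"
    and \<gamma>: "0 < \<gamma>min" "\<gamma>min \<le> \<gamma>max"
    and t: "\<And>k. t k \<ge> 0"
    and GDERIV: "\<And>i y. i \<in> {1..N} \<Longrightarrow> GDERIV (f i) y :> grad (f i) y"
    and lipschitz: "\<And>i. i \<in> {1..N} \<Longrightarrow> L-lipschitz_on UNIV (grad (f i))"
    and k_large: "L * \<gamma>max \<le> 2 * (1 - \<eta>) * real k"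
    and "\<eta> < 1"
  defines "H \<equiv> avg_grad f {1..N} (x k)"
    and "r \<equiv> (\<Sum>i<m. 1 / real (k + i))"
  shows "avg_obj f {1..N} (x (k + m)) \<le> avg_obj f {1..N} (x k)
    - \<gamma>max * r * (H \<bullet> g k) + (\<gamma>max - \<gamma>min) * r * max 0 (H \<bullet> g k)
    + L * (real m * (1 + L * \<gamma>max) ^ m)\<^sup>2 * (\<gamma>max / real k)\<^sup>2 * ((norm H)\<^sup>2 + (norm (g k))\<^sup>2)"
proof -
  note run' = run[unfolded slises_run_def, THEN conjunct2, rule_format]
  have "L \<ge> 0"
    using lipschitz[OF S] by (rule lipschitz_on_nonneg)
  have constant_sample: "NN (k + i) = NN k" if "i < m" for i
    using that
  proof (induction i)
    case (Suc i)
    have "\<not> m dvd k + Suc i"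
      using \<open>m dvd k\<close> Suc.prems dvd_add_right_iff[of m k "Suc i"] nat_dvd_not_less[of "Suc i" m] by blast
    then have "NN (k + Suc i) = NN (k + Suc i - 1)"
      using run'[of "k + Suc i"] by metis
    then show ?case
      using Suc by simp
  qed simp
  have "NN k \<in> subsamples N S"
    using run'[of k] \<open>m dvd k\<close> by simp
  then have A: "finite (NN k)" "NN k \<noteq> {}" "NN k \<subseteq> {1..N}"
    using S by (auto simp: subsamples_def intro: finite_subset)
  let ?h = "avg_grad f (NN k)"
  have F: "GDERIV (avg_obj f (NN k)) y :> ?h y" for y
    using A GDERIV by (intro GDERIV_avg_obj) auto
  have h: "norm (?h y - ?h z) \<le> L * norm (y - z)" for y z
    using A lipschitz by (intro avg_grad_lipschitz) auto
  have g: "g (k + i) = ?h (x (k + i))" if "i < m" for i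
    using run'[of "k + i"] constant_sample[OF that] by simp
  have \<gamma>_bounds: "\<gamma>min / real (k + i) \<le> \<gamma> (k + i) \<and> \<gamma> (k + i) \<le> \<gamma>max / real (k + i)" for i
  proof -
    have "\<gamma> (k + i) = min \<gamma>max (max \<gamma>min (c (k + i))) / real (k + i)"
      using run'[of "k + i"] \<open>k \<ge> 1\<close> by (simp add: max_def)
    then show ?thesis
      using \<gamma> by (auto intro!: divide_right_mono)
  qed
  have \<gamma>_nonneg: "0 \<le> \<gamma> (k + i)" for i
    using \<gamma>_bounds[of i] \<gamma> by (meson divide_nonneg_nonneg less_imp_le of_nat_0_le_iff order_trans)
  have \<gamma>_le: "\<gamma> (k + i) \<le> \<gamma>max / real k" for i
    using \<gamma>_bounds[of i] \<gamma> \<open>k \<ge> 1\<close> frac_le[of \<gamma>max \<gamma>max "real k" "real (k + i)"] by simp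
  have "\<alpha> (k + i) = 1" if "i < m" for i
  proof -
    have "L * \<gamma> (k + i) \<le> L * (\<gamma>max / real k)"
      using \<gamma>_le \<open>L \<ge> 0\<close> by (rule mult_left_mono)
    also have "\<dots> \<le> 2 * (1 - \<eta>)"
      using k_large \<open>k \<ge> 1\<close> by (simp add: field_simps)
    finally show ?thesis
      using run'[of "k + i"] lsp_full_step[OF F h \<gamma>_nonneg[of i], of \<eta> "t (k + i)" "x (k + i)"] t
        constant_sample[OF that] by simp
  qed
  then have step: "x (k + Suc i) = x (k + i) - \<gamma> (k + i) *\<^sub>R ?h (x (k + i))" if "i < m" for i
    using run'[of "k + i"] g[OF that] that by simp
  have sum_bounds: "\<gamma>min * r \<le> (\<Sum>i<m. \<gamma> (k + i))" "(\<Sum>i<m. \<gamma> (k + i)) \<le> \<gamma>max * r"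
    using \<gamma>_bounds unfolding r_def sum_distrib_left by (auto intro!: sum_mono)
  have "avg_obj f {1..N} (x (k + m)) \<le> avg_obj f {1..N} (x (k + 0))
    - (\<gamma>max * r) * (avg_grad f {1..N} (x (k + 0)) \<bullet> ?h (x (k + 0)))
    + (\<gamma>max * r - \<gamma>min * r) * max 0 (avg_grad f {1..N} (x (k + 0)) \<bullet> ?h (x (k + 0)))
    + L * (real m * (1 + L * \<gamma>max) ^ m)\<^sup>2 * (\<gamma>max / real k)\<^sup>2
      * ((norm (avg_grad f {1..N} (x (k + 0))))\<^sup>2 + (norm (?h (x (k + 0))))\<^sup>2)"
  proof (rule gradient_steps_descent[where \<beta> = "\<lambda>i. \<gamma> (k + i)" and L = L and z = "\<lambda>i. x (k + i)"])
    show "GDERIV (avg_obj f {1..N}) y :> avg_grad f {1..N} y" for y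
      using GDERIV by (rule GDERIV_avg_obj)
    show "norm (avg_grad f {1..N} y - avg_grad f {1..N} z) \<le> L * norm (y - z)" for y z
      using S lipschitz by (intro avg_grad_lipschitz) auto
    show "\<gamma>max / real k \<le> \<gamma>max" "\<gamma>max / real k \<ge> 0"
      using \<gamma> \<open>k \<ge> 1\<close> by (auto simp: field_simps mult_le_cancel_left1)
  qed (use h step \<gamma>_nonneg \<gamma>_le \<open>L \<ge> 0\<close> sum_bounds in auto)
  then show ?thesis
    using g[of 0] \<open>m \<ge> 1\<close> by (simp add: H_def left_diff_distrib)
qed

section \<open>Functions of the history of subsamples\<close>

text \<open>Functions of the first \<open>k\<close> subsamples. Stating this by comparing outcomes, instead of exhibiting a
  function on tuples of subsamples, makes closure under composition immediate.\<close>
definition history_determined :: "'w measure \<Rightarrow> (nat \<Rightarrow> 'w \<Rightarrow> 'i) \<Rightarrow> nat \<Rightarrow> ('w \<Rightarrow> 'v) \<Rightarrow> bool" where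
  "history_determined M NN k X \<longleftrightarrow>
    (\<forall>w\<in>space M. \<forall>w'\<in>space M. (\<forall>j<k. NN j w = NN j w') \<longrightarrow> X w = X w')"

lemma subalgebra_past_algebra:
  assumes "\<And>j. NN j \<in> M \<rightarrow>\<^sub>M count_space I"
  shows "subalgebra M (past_algebra M NN k)"
proof -
  have "NN j -` {A} \<inter> space M \<in> sets M" for j A
  proof (cases "A \<in> I")
    case True
    then show ?thesis
      using measurable_sets[OF assms, of "{A}" j] by simp
  next
    case False
    then have "NN j -` {A} \<inter> space M = {}"
      using measurable_space[OF assms, of _ j] by auto
    then show ?thesis
      by simp
  qed
  then have "{NN j -` {A} \<inter> space M | j A. j < k} \<subseteq> sets M"
    by auto
  moreover have "{NN j -` {A} \<inter> space M | j A. j < k} \<subseteq> Pow (space M)"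
    by auto
  ultimately show ?thesis
    unfolding subalgebra_def past_algebra_def
    by (simp add: space_measure_of_conv sets_measure_of sets.sigma_sets_subset)
qed

text \<open>The first \<open>k\<close> subsamples split the space into finitely many atoms of the past algebra, and \<open>X\<close> is
  constant on each of them. This works for any target space \<open>N\<close>, and it also shows that \<open>X\<close> takes
  finitely many values, which makes a real-valued \<open>X\<close> integrable.\<close>
lemma
  assumes "finite I" "\<And>j w. w \<in> space M \<Longrightarrow> NN j w \<in> I"
    and X: "history_determined M NN k X"
  shows history_determined_measurable:
      "X \<in> space M \<rightarrow> space N \<Longrightarrow> X \<in> past_algebra M NN k \<rightarrow>\<^sub>M N"
    and finite_image_history_determined: "finite (X ` space M)"
proof -
  define h where "h w = map (\<lambda>j. NN j w) [0..<k]" for w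
  have h_eq: "h w = h w' \<longleftrightarrow> (\<forall>j<k. NN j w = NN j w')" for w w'
    by (auto simp: h_def)
  have "h ` space M \<subseteq> {l. set l \<subseteq> I \<and> length l = k}"
    using assms(2) by (auto simp: h_def)
  then have finite_h: "finite (h ` space M)"
    by (rule finite_subset) (rule finite_lists_length_eq[OF \<open>finite I\<close>])
  have X_h: "X w = X w'" if "w \<in> space M" "w' \<in> space M" "h w = h w'" for w w'
    using X that unfolding history_determined_def h_eq by blast
  have "X ` space M \<subseteq> (\<lambda>l. X (inv_into (space M) h l)) ` h ` space M"
  proof (rule image_subsetI)
    fix w assume "w \<in> space M"
    then have "X w = X (inv_into (space M) h (h w))"
      by (intro X_h) (auto simp: inv_into_into f_inv_into_f)
    then show "X w \<in> (\<lambda>l. X (inv_into (space M) h l)) ` h ` space M"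
      using \<open>w \<in> space M\<close> by blast
  qed
  then show "finite (X ` space M)"
    using finite_h by (meson finite_imageI finite_subset)
  have space: "space (past_algebra M NN k) = space M"
    by (auto simp: past_algebra_def space_measure_of_conv)
  have top: "space M \<in> sets (past_algebra M NN k)"
    using sets.top[of "past_algebra M NN k"] by (simp only: space)
  have gen: "NN j -` {A} \<inter> space M \<in> sets (past_algebra M NN k)" if "j < k" for j A
    unfolding past_algebra_def using that by (intro in_measure_of) auto
  have atom: "{w' \<in> space M. h w' = h w} \<in> sets (past_algebra M NN k)" for w
  proof -
    have "{w' \<in> space M. h w' = h w} = space M \<inter> (\<Inter>j\<in>{..<k}. NN j -` {NN j w} \<inter> space M)"
      by (auto simp: h_eq)
    also have "\<dots> \<in> sets (past_algebra M NN k)"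
    proof (cases "k = 0")
      case True
      then show ?thesis
        using top by simp
    next
      case False
      then show ?thesis
        using gen by (intro sets.Int[OF top] sets.finite_INT) auto
    qed
    finally show ?thesis .
  qed
  show "X \<in> past_algebra M NN k \<rightarrow>\<^sub>M N" if "X \<in> space M \<rightarrow> space N"
  proof (rule measurableI)
    fix E assume "E \<in> sets N"
    have "X -` E \<inter> space M
        = (\<Union>l\<in>h ` {w \<in> space M. X w \<in> E}. {w' \<in> space M. h w' = l})"
      by (auto dest: X_h)
    also have "\<dots> \<in> sets (past_algebra M NN k)"
    proof (rule sets.finite_UN)
      show "finite (h ` {w \<in> space M. X w \<in> E})"
        by (rule finite_subset[OF _ finite_h]) auto
    qed (use atom in auto)
    finally show "X -` E \<inter> space (past_algebra M NN k) \<in> sets (past_algebra M NN k)"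
      unfolding space .
  qed (use that space in auto)
qed

lemma integrable_finite_image:
  fixes X :: "'w \<Rightarrow> real"
  assumes "finite_measure M" "X \<in> borel_measurable M" "finite (X ` space M)"
  shows "integrable M X"
proof (rule finite_measure.integrable_const_bound[OF assms(1)])
  show "AE w in M. norm (X w) \<le> Max ((\<lambda>v. norm v) ` X ` space M)"
    using assms(3) by (intro AE_I2 Max_ge) auto
qed fact

text \<open>The algorithm itself is deterministic: the subsamples \<open>0, \<dots>, k - 1\<close> fix the iterate \<open>k\<close>, even when a
  line search does not terminate, because \<open>lsp\<close> is a function of its arguments in that case too.\<close>
lemma slises_run_determined:
  assumes run: "slises_run f N S m \<eta> \<gamma>min \<gamma>max t x0 NN x g c \<gamma> d \<alpha>"
    and run': "slises_run f N S m \<eta> \<gamma>min \<gamma>max t x0 NN' x' g' c' \<gamma>' d' \<alpha>'"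
    and "\<And>j. j < k \<Longrightarrow> NN j = NN' j"
  shows "x k = x' k"
proof -
  note step = run[unfolded slises_run_def, THEN conjunct2, rule_format]
  note step' = run'[unfolded slises_run_def, THEN conjunct2, rule_format]
  have "\<forall>j\<le>k. x j = x' j"
    using assms(3)
  proof (induction k)
    case 0
    then show ?case
      using run run' by (simp add: slises_run_def)
  next
    case (Suc k)
    then have x: "x j = x' j" if "j \<le> k" for j
      using that by simp
    then have g: "g j = g' j" if "j \<le> k" for j
      using that Suc.prems[of j] step[of j] step'[of j] by simp
    have "c k = c' k"
      using step[of k] step'[of k] x g by (simp add: slises_coeff_def)
    then have "\<gamma> k = \<gamma>' k"
      using step[of k] step'[of k] by simp
    then have d: "d k = d' k"
      using step[of k] step'[of k] g by simp
    have "\<alpha> k = lsp (avg_obj f (NN k)) (x k) (d k) (g k \<bullet> d k) \<eta> (t k)"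
      using step by blast
    also have "\<dots> = lsp (avg_obj f (NN' k)) (x' k) (d' k) (g' k \<bullet> d' k) \<eta> (t k)"
      using x[of k] g[of k] d Suc.prems[of k] by simp
    also have "\<dots> = \<alpha>' k"
      using step' by simp
    finally have \<alpha>: "\<alpha> k = \<alpha>' k" .
    have "x (Suc k) = x k + \<alpha> k *\<^sub>R d k"
      using step by blast
    also have "\<dots> = x' k + \<alpha>' k *\<^sub>R d' k"
      using x[of k] \<alpha> d by simp
    also have "\<dots> = x' (Suc k)"
      using step' by simp
    finally have "x (Suc k) = x' (Suc k)" .
    then show ?case
      using x by (auto simp: le_Suc_eq)
  qed
  then show ?thesis by simp
qed

section \<open>Means of conditional quantities\<close>

text \<open>Drawing \<open>Z\<close> with conditional probabilities \<open>q\<close> given \<open>F\<close> amounts, for the mean of an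
  \<open>F\<close>-measurable family evaluated at \<open>Z\<close>, to weighting every member by \<open>q\<close>: split according to the
  value of \<open>Z\<close> and replace the indicator of each value by its conditional expectation.\<close>
lemma integral_uniform_choice:
  fixes Y :: "'i \<Rightarrow> 'w \<Rightarrow> real"
  assumes "finite_measure M" "subalgebra M F" "finite I" and Z: "Z \<in> M \<rightarrow>\<^sub>M count_space I"
    and cprob: "\<And>i. i \<in> I \<Longrightarrow> AE w in M. cprob M F {v \<in> space M. Z v = i} w = q"
    and Y: "\<And>i. i \<in> I \<Longrightarrow> Y i \<in> borel_measurable F" "\<And>i. i \<in> I \<Longrightarrow> integrable M (Y i)"
  shows "(\<integral>w. Y (Z w) w \<partial>M) = q * (\<integral>w. (\<Sum>i\<in>I. Y i w) \<partial>M)"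
proof -
  interpret finite_measure_subalgebra M F
    using assms by (simp add: finite_measure_subalgebra_def finite_measure_subalgebra_axioms_def)
  define E where "E i = {v \<in> space M. Z v = i}" for i
  have E: "E i \<in> sets M" if "i \<in> I" for i
    using measurable_sets[OF Z, of "{i}"] that by (simp add: E_def vimage_def Int_def conj_commute)
  have "(\<integral>w. Y (Z w) w \<partial>M) = (\<integral>w. (\<Sum>i\<in>I. Y i w * indicator (E i) w) \<partial>M)"
  proof (rule Bochner_Integration.integral_cong[OF refl])
    fix w assume "w \<in> space M"
    then have "Z w \<in> I"
      using measurable_space[OF Z] by auto
    then show "Y (Z w) w = (\<Sum>i\<in>I. Y i w * indicator (E i) w)"
      using \<open>w \<in> space M\<close> \<open>finite I\<close>
      by (subst sum.remove[of _ "Z w"]) (auto simp: E_def indicator_def intro!: sum.neutral)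
  qed
  also have "\<dots> = (\<Sum>i\<in>I. \<integral>w. Y i w * indicator (E i) w \<partial>M)"
    using Y E by (intro Bochner_Integration.integral_sum integrable_real_mult_indicator)
  also have "\<dots> = (\<Sum>i\<in>I. q * (\<integral>w. Y i w \<partial>M))"
  proof (rule sum.cong[OF refl])
    fix i assume i: "i \<in> I"
    have "(\<integral>w. Y i w * indicator (E i) w \<partial>M) = (\<integral>w. Y i w * real_cond_exp M F (indicator (E i)) w \<partial>M)"
      using Y[OF i] E[OF i] by (intro real_cond_exp_intg(2)[symmetric] integrable_real_mult_indicator) auto
    also have "\<dots> = (\<integral>w. q * Y i w \<partial>M)"
      using cprob[OF i] Y[OF i] measurable_from_subalg[OF subalg]
      by (intro integral_cong_AE borel_measurable_times) (auto simp: cprob_def E_def)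
    finally show "(\<integral>w. Y i w * indicator (E i) w \<partial>M) = q * (\<integral>w. Y i w \<partial>M)"
      by simp
  qed
  also have "\<dots> = q * (\<integral>w. (\<Sum>i\<in>I. Y i w) \<partial>M)"
    using Y(2) by (simp add: sum_distrib_left Bochner_Integration.integral_sum)
  finally show ?thesis .
qed

text \<open>Away from the set \<open>Z\<close> where the conditional probability of \<open>E\<close> vanishes, the product is the conditional
  expectation of \<open>X\<close> restricted to \<open>E\<close>. On \<open>Z\<close> it is \<open>0\<close> by the convention for division by
  zero, and nothing is lost there since \<open>Z \<inter> E\<close> is a null set.\<close>
lemma integral_cprob_cexp_event:
  assumes "finite_measure M" "subalgebra M F" and E: "E \<in> sets M" and X: "integrable M X"
  shows "integrable M (\<lambda>w. cprob M F E w * cexp_event M F X E w)"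
    and "(\<integral>w. cprob M F E w * cexp_event M F X E w \<partial>M) = (\<integral>w. X w * indicator E w \<partial>M)"
proof -
  interpret finite_measure_subalgebra M F
    using assms by (simp add: finite_measure_subalgebra_def finite_measure_subalgebra_axioms_def)
  let ?p = "cprob M F E"
  define Z where "Z = {w \<in> space M. ?p w = 0}"
  have p_F: "?p \<in> borel_measurable F"
    by (simp add: cprob_def)
  have Z_F: "Z \<in> sets F"
    using measurable_sets[OF p_F, of "{0}"] subalg
    by (simp add: Z_def subalgebra_def vimage_def Int_def conj_commute)
  have sub: "A \<in> sets F \<Longrightarrow> A \<in> sets M" for A
    using subalg by (auto simp: subalgebra_def)
  have "integrable M (\<lambda>w. indicator Z w * indicator E w :: real)"
    using E sub[OF Z_F] by (intro integrable_real_mult_indicator integrable_real_indicator) (auto simp: less_top[symmetric])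
  then have "(\<integral>w. indicator Z w * indicator E w \<partial>M) = (\<integral>w. indicator Z w * ?p w \<partial>M)"
    unfolding cprob_def using Z_F E by (intro real_cond_exp_intg(2)[symmetric]) auto
  also have "\<dots> = 0"
    by (rule integral_eq_zero_AE) (auto simp: Z_def indicator_def)
  finally have "measure M (Z \<inter> E) = 0"
    using E sub[OF Z_F] by (simp flip: indicator_inter_arith)
  then have null: "AE w in M. w \<notin> Z \<inter> E"
    using E sub[OF Z_F] by (intro AE_not_in) (auto simp: null_sets_def emeasure_eq_measure)
  have XE: "integrable M (\<lambda>w. X w * indicator E w)"
    using X E by (rule integrable_real_mult_indicator[rotated])
  have XEZ: "integrable M (\<lambda>w. indicator (space M - Z) w * (X w * indicator E w))"
    using integrable_real_mult_indicator[OF _ XE, of "space M - Z"] sub[OF Z_F] by (simp add: mult.commute)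
  have eq: "?p w * cexp_event M F X E w
      = indicator (space M - Z) w * real_cond_exp M F (\<lambda>v. X v * indicator E v) w" if "w \<in> space M" for w
    using that by (auto simp: cexp_event_def Z_def indicator_def)
  have ind: "indicator (space M - Z) \<in> borel_measurable F"
    using Z_F subalg sets.compl_sets[of Z F] by (auto simp: subalgebra_def)
  note intg = real_cond_exp_intg[OF XEZ ind borel_measurable_integrable[OF XE]]
  show "integrable M (\<lambda>w. ?p w * cexp_event M F X E w)"
    using intg(1) eq by (simp cong: Bochner_Integration.integrable_cong)
  have "(\<integral>w. ?p w * cexp_event M F X E w \<partial>M)
      = (\<integral>w. indicator (space M - Z) w * (X w * indicator E w) \<partial>M)"
    using intg(2) eq by (simp cong: Bochner_Integration.integral_cong)
  also have "\<dots> = (\<integral>w. X w * indicator E w \<partial>M)"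
    using null XEZ XE by (intro integral_cong_AE) (auto simp: indicator_def)
  finally show "(\<integral>w. ?p w * cexp_event M F X E w \<partial>M) = (\<integral>w. X w * indicator E w \<partial>M)" .
qed

section \<open>From a recursion of means to the almost sure limit\<close>

lemma summable_decrements:
  fixes a b e :: "nat \<Rightarrow> real"
  assumes rec: "\<And>j. j \<ge> J \<Longrightarrow> a (Suc j) \<le> a j - b j + e j"
    and "\<And>j. a j \<ge> l" "\<And>j. b j \<ge> 0" "\<And>j. e j \<ge> 0" "summable e"
  shows "summable b"
proof -
  have b: "(\<Sum>i<n. b (i + J)) \<le> a J - a (n + J) + (\<Sum>i<n. e (i + J))" for n
  proof (induction n)
    case (Suc n)
    then show ?case
      using rec[of "n + J"] by simp
  qed simp
  have e: "(\<Sum>i<n. e (i + J)) \<le> (\<Sum>i. e (i + J))" for n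
    using assms by (intro sum_le_suminf) (auto simp: summable_iff_shift)
  have "(\<Sum>i<n. b (i + J)) \<le> a J - l + (\<Sum>i. e (i + J))" for n
    using b[of n] e[of n] assms(2)[of "n + J"] by linarith
  then have "summable (\<lambda>i. b (i + J))"
    using assms(3) by (intro summableI_nonneg_bounded)
  then show ?thesis
    by (simp add: summable_iff_shift)
qed

lemma AE_summable_if_summable_integral:
  fixes Y :: "nat \<Rightarrow> 'w \<Rightarrow> real"
  assumes "\<And>j. integrable M (Y j)" "\<And>j w. Y j w \<ge> 0" "summable (\<lambda>j. \<integral>w. Y j w \<partial>M)"
  shows "AE w in M. summable (\<lambda>j. Y j w)"
proof -
  have "(\<integral>\<^sup>+w. (\<Sum>j. ennreal (Y j w)) \<partial>M) = (\<Sum>j. \<integral>\<^sup>+w. ennreal (Y j w) \<partial>M)"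
    using assms(1) by (intro nn_integral_suminf) auto
  also have "\<dots> = (\<Sum>j. ennreal (\<integral>w. Y j w \<partial>M))"
    using assms by (simp add: nn_integral_eq_integral)
  also have "\<dots> \<noteq> \<infinity>"
    using assms by (simp add: suminf_ennreal2)
  finally have "AE w in M. (\<Sum>j. ennreal (Y j w)) \<noteq> \<infinity>"
    using assms(1) by (intro nn_integral_PInf_AE) auto
  then show ?thesis
    by (rule eventually_mono) (use assms(2) in \<open>auto intro: summable_suminf_not_top\<close>)
qed

text \<open>If \<open>y j \<ge> \<epsilon>\<close> held eventually, the series would dominate \<open>\<epsilon>\<close> times the harmonic series.\<close>
lemma frequently_small_if_summable_divide_index:
  fixes y :: "nat \<Rightarrow> real"
  assumes "summable (\<lambda>j. y j / real j)" "\<epsilon> > 0"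
  shows "\<exists>\<^sub>F j in sequentially. y j < \<epsilon>"
proof (rule ccontr)
  assume "\<not> (\<exists>\<^sub>F j in sequentially. y j < \<epsilon>)"
  then have "\<forall>\<^sub>F j in sequentially. \<not> y j < \<epsilon>"
    by (simp add: frequently_def)
  then have "\<forall>\<^sub>F j in sequentially. norm (1 / real j) \<le> (y j / real j) / \<epsilon>"
  proof (rule eventually_mono)
    fix j assume "\<not> y j < \<epsilon>"
    then have "1 \<le> y j / \<epsilon>"
      using \<open>\<epsilon> > 0\<close> by simp
    then have "1 / real j \<le> y j / \<epsilon> / real j"
      by (intro divide_right_mono) auto
    then show "norm (1 / real j) \<le> (y j / real j) / \<epsilon>"
      by (simp add: mult.commute)
  qed
  then have "summable (\<lambda>j. 1 / real j)"
    by (rule summable_comparison_test_ev) (intro summable_divide assms)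
  then show False
    using not_summable_harmonic[where 'a = real] by (simp add: inverse_eq_divide)
qed

text \<open>With \<open>k = j m\<close> the sum \<open>r\<close> of the reciprocals of \<open>k, \<dots>, k + m - 1\<close> lies between \<open>1 / (2 j)\<close> and
  \<open>1 / j\<close>. Because \<open>\<theta> \<le> s\<close>, the first two terms with \<open>n j\<close> leave a decrease of at least
  \<open>\<gamma>min r n j\<close>, that is, of \<open>\<gamma>min / (2 j) \<cdot> n j\<close>. For large \<open>j\<close> half of it pays for the
  quadratic term in \<open>n j\<close>, and the errors that do not contain \<open>n j\<close> are summable.\<close>
lemma summable_cycle_recursion:
  fixes a n :: "nat \<Rightarrow> real" and m :: nat
  assumes m: "m \<ge> 1" and \<gamma>: "0 < \<gamma>min" "\<gamma>min \<le> \<gamma>max"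
    and "0 \<le> \<theta>" "\<theta> \<le> s" "1 \<le> s" "C \<ge> 0" "\<delta> > 0" "K \<ge> 0" "G \<ge> 0"
    and a: "\<And>j. a j \<ge> l" and n: "\<And>j. n j \<ge> 0"
    and rec: "\<And>j. j \<ge> J \<Longrightarrow> j \<ge> 1 \<Longrightarrow>
      a (Suc j) \<le> a j - \<gamma>max * (\<Sum>i<m. 1 / real (j * m + i)) * n j
        + (\<gamma>max - \<gamma>min) * (\<Sum>i<m. 1 / real (j * m + i)) * (\<theta> / s * n j + C / (s * real (j * m) powr \<delta>))
        + K * (\<gamma>max / real (j * m))\<^sup>2 * (n j + (2 * n j + 2 * G))"
  shows "summable (\<lambda>j. n j / real j)"
proof -
  define D where "D = (\<gamma>max - \<gamma>min) * C"
  define E where "E = K * \<gamma>max\<^sup>2"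
  define e where "e j = D * real j powr - (1 + \<delta>) + 2 * G * E * real j powr - 2" for j
  \<comment> \<open>From this index on, \<open>3 E / j\<^sup>2 \<le> \<gamma>min / (4 j)\<close>, which absorbs the quadratic term.\<close>
  define J' where "J' = max (max J 1) (nat \<lceil>12 * E / \<gamma>min\<rceil>)"
  have "D \<ge> 0" "E \<ge> 0"
    using assms by (auto simp: D_def E_def)
  have "summable (\<lambda>j. \<gamma>min / 4 * (n j / real j))"
  proof (rule summable_decrements[where a = a and l = l and J = J' and e = e])
    show "summable e"
      unfolding e_def using \<open>\<delta> > 0\<close>
      by (intro summable_add summable_mult) (auto simp: summable_real_powr_iff)
    show "e j \<ge> 0" for j
      using \<open>D \<ge> 0\<close> \<open>E \<ge> 0\<close> \<open>G \<ge> 0\<close> by (auto simp: e_def)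
    fix j assume "j \<ge> J'"
    then have j: "j \<ge> J" "j \<ge> 1" and "12 * E / \<gamma>min \<le> real j"
      by (auto simp: J'_def nat_ceiling_le_eq)
    then have jE: "12 * E \<le> \<gamma>min * real j"
      using \<gamma> by (simp add: field_simps)
    define r where "r = (\<Sum>i<m. 1 / real (j * m + i))"
    have jm: "real j \<le> real (j * m)"
      using m by (simp del: of_nat_mult)
    \<comment> \<open>Each \<open>j m + i\<close> with \<open>i < m\<close> is at most \<open>2 j m\<close>, as \<open>j \<ge> 1\<close>.\<close>
    have "r \<ge> (\<Sum>i<m. 1 / real (2 * j * m))"
      unfolding r_def
    proof (rule sum_mono)
      fix i assume "i \<in> {..<m}"
      then have "j * m + i \<le> j * m + j * m"
        using \<open>j \<ge> 1\<close> by (metis add_left_mono lessThan_iff less_imp_le mult_le_mono1 nat_mult_1 order_trans)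
      then have "real (j * m + i) \<le> real (2 * j * m)"
        by (simp only: of_nat_le_iff)
      moreover have "0 < j * m + i"
        using j m by simp
      ultimately show "1 / real (2 * j * m) \<le> 1 / real (j * m + i)"
        by (intro divide_left_mono mult_pos_pos) (use j m in \<open>auto simp del: of_nat_mult of_nat_add\<close>)
    qed
    then have r_lower: "r \<ge> 1 / (2 * real j)"
      using m by (simp add: field_simps)
    have "r \<le> (\<Sum>i<m. 1 / real (j * m))"
      unfolding r_def using j m by (intro sum_mono frac_le) auto
    then have r_upper: "r \<le> 1 / real j"
      using m by (simp add: field_simps)
    have "r \<ge> 0"
      unfolding r_def by (intro sum_nonneg) auto
    have "(\<gamma>max - \<gamma>min) * r * (\<theta> / s * n j) \<le> (\<gamma>max - \<gamma>min) * r * (1 * n j)"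
      using assms \<open>r \<ge> 0\<close> by (intro mult_left_mono mult_right_mono) auto
    moreover have "\<gamma>min * (1 / (2 * real j)) * n j \<le> \<gamma>min * r * n j"
      using r_lower \<gamma> n by (intro mult_left_mono mult_right_mono) auto
    moreover have "(\<gamma>max - \<gamma>min) * r * (C / (s * real (j * m) powr \<delta>)) \<le> D * real j powr - (1 + \<delta>)"
    proof -
      have "C / (s * real (j * m) powr \<delta>) \<le> C / (1 * real j powr \<delta>)"
        using assms j jm by (intro divide_left_mono mult_mono powr_mono2) auto
      then have "r * (C / (s * real (j * m) powr \<delta>)) \<le> 1 / real j * (C / (1 * real j powr \<delta>))"
        using r_upper assms by (intro mult_mono) auto
      also have "\<dots> = C * real j powr - (1 + \<delta>)"
        using j by (simp only: powr_minus_divide powr_add) simp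
      finally have "(\<gamma>max - \<gamma>min) * (r * (C / (s * real (j * m) powr \<delta>)))
          \<le> (\<gamma>max - \<gamma>min) * (C * real j powr - (1 + \<delta>))"
        using \<gamma> by (intro mult_left_mono) auto
      then show ?thesis
        by (simp only: D_def mult.assoc)
    qed
    moreover have "K * (\<gamma>max / real (j * m))\<^sup>2 * (n j + (2 * n j + 2 * G))
        \<le> \<gamma>min / 4 * (n j / real j) + 2 * G * E * real j powr - 2"
    proof -
      have "K * (\<gamma>max / real (j * m))\<^sup>2 * (n j + (2 * n j + 2 * G))
          \<le> K * (\<gamma>max / real j)\<^sup>2 * (3 * n j + 2 * G)"
        using assms j jm n[of j]
        by (intro mult_mono mult_left_mono power_mono divide_left_mono) (auto intro!: mult_nonneg_nonneg)
      also have "\<dots> = 3 * E / (real j)\<^sup>2 * n j + 2 * G * E * real j powr - 2"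
        using j by (simp add: E_def powr_minus powr_numeral field_simps)
      also have "3 * E / (real j)\<^sup>2 * n j \<le> \<gamma>min / 4 * (n j / real j)"
      proof -
        have "12 * E * (n j / (real j)\<^sup>2) \<le> \<gamma>min * real j * (n j / (real j)\<^sup>2)"
          using jE n[of j] by (intro mult_right_mono) auto
        then show ?thesis
          using j by (simp add: power2_eq_square)
      qed
      finally show ?thesis by simp
    qed
    ultimately show "a (Suc j) \<le> a j - \<gamma>min / 4 * (n j / real j) + e j"
      using rec[OF j, folded r_def] unfolding e_def by (simp add: algebra_simps)
  qed (use a n \<gamma> in auto)
  then show ?thesis
    using \<gamma> by (subst (asm) summable_cmult_iff) auto
qed

lemma liminf_eq_0_along_subsequence:
  fixes y :: "nat \<Rightarrow> real"
  assumes "\<And>k. y k \<ge> 0" "m \<ge> 1"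
    and small: "\<And>\<epsilon>. \<epsilon> > 0 \<Longrightarrow> \<exists>\<^sub>F j in sequentially. y (j * m) < \<epsilon>"
  shows "liminf (\<lambda>k. ereal (y k)) = 0"
proof (rule antisym)
  show "0 \<le> liminf (\<lambda>k. ereal (y k))"
    using assms(1) by (intro Liminf_bounded) auto
  show "liminf (\<lambda>k. ereal (y k)) \<le> 0"
  proof (rule ccontr)
    assume "\<not> liminf (\<lambda>k. ereal (y k)) \<le> 0"
    then obtain \<epsilon> where \<epsilon>: "0 < ereal \<epsilon>" "ereal \<epsilon> < liminf (\<lambda>k. ereal (y k))"
      using ereal_dense2[of 0] by (auto simp: not_le)
    then have "\<forall>\<^sub>F k in sequentially. \<epsilon> < y k"
      using less_LiminfD by fastforce
    then obtain K where K: "\<And>k. k \<ge> K \<Longrightarrow> \<epsilon> < y k"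
      by (auto simp: eventually_sequentially)
    have "\<epsilon> < y (j * m)" if "j \<ge> K" for j
      using that \<open>m \<ge> 1\<close> by (intro K) (metis le_trans mult_le_mono nat_mult_1_right)
    then have "\<not> (\<exists>\<^sub>F j in sequentially. y (j * m) < \<epsilon>)"
      by (auto simp: frequently_def eventually_sequentially not_less intro!: exI[of _ K] less_imp_le)
    then show False
      using small[of \<epsilon>] \<epsilon> by simp
  qed
qed

section \<open>Convergence of the gradients\<close>

theorem theorem3p2:
  fixes M :: "'w measure"
    and f :: "nat \<Rightarrow> real ^ 'n \<Rightarrow> real"
    and N S m :: nat
    and \<eta> \<gamma>min \<gamma>max tbar L G C \<theta> \<delta> :: real
    and t :: "nat \<Rightarrow> real"
    and x0 :: "real ^ 'n"
    and NN :: "nat \<Rightarrow> 'w \<Rightarrow> nat set"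
    and x g d :: "nat \<Rightarrow> 'w \<Rightarrow> real ^ 'n"
    and c \<gamma> \<alpha> :: "nat \<Rightarrow> 'w \<Rightarrow> real"
  defines "obj \<equiv> avg_obj f {1..N}"
    and "\<F> \<equiv> past_algebra M NN"
    and "s \<equiv> card (subsamples N S)"
    and "B \<equiv> (\<lambda>k. {w \<in> space M. grad (avg_obj f {1..N}) (x k w) \<bullet> avg_grad f (NN k w) (x k w) \<ge> 0})"
  assumes "prob_space M"
    and "S \<in> {1..N}" and "m \<ge> 1"
    and "0 < \<eta>" and "\<eta> < 1"
    and "0 < \<gamma>min" and "\<gamma>min \<le> 1" and "1 \<le> \<gamma>max"
    and "\<And>k. t k \<ge> 0" and "summable t" and "(\<Sum>k. t k) \<le> tbar"
    and NN_rv: "\<And>k. NN k \<in> M \<rightarrow>\<^sub>M count_space (subsamples N S)"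
    and run: "\<And>w. w \<in> space M \<Longrightarrow>
          slises_run f N S m \<eta> \<gamma>min \<gamma>max t x0 (\<lambda>k. NN k w) (\<lambda>k. x k w) (\<lambda>k. g k w)
            (\<lambda>k. c k w) (\<lambda>k. \<gamma> k w) (\<lambda>k. d k w) (\<lambda>k. \<alpha> k w)"
    and unif: "uniform_sampling M N S m NN"
    and A1: "\<And>i. i \<in> {1..N} \<Longrightarrow> bdd_below (range (f i))"
            "\<And>i. i \<in> {1..N} \<Longrightarrow> twice_continuously_differentiable (f i)"
            "\<And>i. i \<in> {1..N} \<Longrightarrow> L-lipschitz_on UNIV (grad (f i))"
    and A2: "G > 0"
            "\<And>k. m dvd k \<Longrightarrow> AE w in M.
               real_cond_exp M (\<F> k) (\<lambda>v. (norm (g k v - grad obj (x k v)))\<^sup>2) w \<le> G"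
    and A3: "C > 0" "\<theta> > 0" "0 < \<delta>" "\<delta> < 1"
            "\<And>k. k \<ge> 1 \<Longrightarrow> m dvd k \<Longrightarrow> AE w in M.
               cprob M (\<F> k) (B k) w *
               cexp_event M (\<F> k) (\<lambda>v. grad obj (x k v) \<bullet> avg_grad f (NN k v) (x k v)) (B k) w
               \<le> (\<theta> / real s) * (norm (grad obj (x k w)))\<^sup>2 + C / (real s * real k powr \<delta>)"
    and "real s \<ge> \<theta>"
  shows "AE w in M. liminf (\<lambda>k. ereal (norm (grad obj (x k w)))) = 0"
proof -
  interpret prob_space M by fact
  note lipschitz = A1(3)
  have GDERIV: "GDERIV (f i) y :> grad (f i) y" if "i \<in> {1..N}" for i y
    using A1(2)[OF that] by (rule twice_continuously_differentiable_GDERIV)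
  have grad_obj: "grad obj y = avg_grad f {1..N} y" for y
    unfolding obj_def using GDERIV by (intro GDERIV_grad_eq GDERIV_avg_obj)
  have NN_in: "NN k w \<in> subsamples N S" if "w \<in> space M" for k w
    using measurable_space[OF NN_rv that] by simp
  have s: "s \<ge> 1"
    using \<open>S \<in> {1..N}\<close> by (simp add: s_def card_subsamples Suc_le_eq)
  have L: "L \<ge> 0"
    using lipschitz[OF \<open>S \<in> {1..N}\<close>] by (rule lipschitz_on_nonneg)
  have \<gamma>: "0 < \<gamma>min" "\<gamma>min \<le> \<gamma>max"
    using \<open>0 < \<gamma>min\<close> \<open>\<gamma>min \<le> 1\<close> \<open>1 \<le> \<gamma>max\<close> by auto
  have g: "g k w = avg_grad f (NN k w) (x k w)" if "w \<in> space M" for k w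
    using run[OF that] by (simp add: slises_run_def)
  have subalg: "subalgebra M (\<F> k)" for k
    unfolding \<F>_def using NN_rv by (rule subalgebra_past_algebra)

  \<comment> \<open>Every random variable of the proof is a function of a history: of length \<open>k\<close> for the iterate \<open>k\<close>, and of length \<open>k + 1\<close> for the gradient, which also sees the subsample \<open>k\<close>.\<close>
  have x_determined: "history_determined M NN k (\<lambda>w. \<phi> (x k w))" for k and \<phi> :: "real ^ 'n \<Rightarrow> real"
    unfolding history_determined_def
    using slises_run_determined[OF run run, of _ _ k] by metis
  have g_determined: "history_determined M NN (Suc k) (\<lambda>w. \<phi> (NN k w) (x k w))"
    for k and \<phi> :: "nat set \<Rightarrow> real ^ 'n \<Rightarrow> real"
    unfolding history_determined_def
    using slises_run_determined[OF run run, of _ _ k] by (metis less_SucI lessI)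
  have past_measurable: "X \<in> borel_measurable (\<F> k)" if "history_determined M NN k X"
    for X :: "'w \<Rightarrow> real" and k
    unfolding \<F>_def using NN_in that by (intro history_determined_measurable[OF finite_subsamples]) auto
  have integrable_determined: "integrable M X" if "history_determined M NN k X"
    for X :: "'w \<Rightarrow> real" and k
    using past_measurable[OF that] measurable_from_subalg[OF subalg]
      finite_image_history_determined[OF finite_subsamples NN_in that]
    by (intro integrable_finite_image) (auto intro: finite_measure_axioms)
  note integrable_x = integrable_determined[OF x_determined]
  note integrable_g = integrable_determined[OF g_determined]

  \<comment> \<open>From here on, the gradient of the subsample is written out instead of \<open>g\<close>, which equals it only on the space of \<open>M\<close>.\<close>
  define n where "n k = (\<integral>w. (norm (grad obj (x k w)))\<^sup>2 \<partial>M)" for k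
  define X where "X k w = grad obj (x k w) \<bullet> avg_grad f (NN k w) (x k w)" for k w
  have n_nonneg: "n k \<ge> 0" for k
    by (simp add: n_def)
  have integrable_X: "integrable M (X k)" for k
    unfolding X_def by (rule integrable_g)
  have integrable_H2: "integrable M (\<lambda>w. (norm (grad obj (x k w)))\<^sup>2)" for k
    by (rule integrable_x)
  have integrable_g2: "integrable M (\<lambda>w. (norm (avg_grad f (NN k w) (x k w)))\<^sup>2)" for k
    by (rule integrable_g)

  have mean_X: "(\<integral>w. X k w \<partial>M) = n k" if "m dvd k" for k
  proof -
    have "(\<integral>w. X k w \<partial>M) = (1 / real s) * (\<integral>w. (\<Sum>A\<in>subsamples N S. grad obj (x k w) \<bullet> avg_grad f A (x k w)) \<partial>M)"
      unfolding X_def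
    proof (rule integral_uniform_choice[where F = "\<F> k"])
      show "AE w in M. cprob M (\<F> k) {v \<in> space M. NN k v = A} w = 1 / real s"
        if "A \<in> subsamples N S" for A
        using unif that \<open>m dvd k\<close> unfolding uniform_sampling_def \<F>_def s_def by blast
    qed (use NN_rv subalg finite_subsamples past_measurable[OF x_determined] integrable_x
          finite_measure_axioms in auto)
    also have "\<dots> = (\<integral>w. grad obj (x k w) \<bullet> ((1 / real s) *\<^sub>R (\<Sum>A\<in>subsamples N S. avg_grad f A (x k w))) \<partial>M)"
      by (simp add: inner_sum_right)
    also have "\<dots> = n k"
      by (simp only: mean_avg_grad_subsamples[OF \<open>S \<in> {1..N}\<close>, folded s_def]
          n_def grad_obj power2_norm_eq_inner)
    finally show ?thesis .
  qed

  have mean_g2: "(\<integral>w. (norm (avg_grad f (NN k w) (x k w)))\<^sup>2 \<partial>M) \<le> 2 * n k + 2 * G" if "m dvd k" for k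
  proof -
    interpret F: finite_measure_subalgebra M "\<F> k"
      using subalg by unfold_locales
    have V: "integrable M (\<lambda>w. (norm (avg_grad f (NN k w) (x k w) - grad obj (x k w)))\<^sup>2)"
      by (rule integrable_g)
    then have V': "integrable M (\<lambda>w. (norm (g k w - grad obj (x k w)))\<^sup>2)"
      using g by (simp cong: Bochner_Integration.integrable_cong)
    have "(\<integral>w. (norm (avg_grad f (NN k w) (x k w) - grad obj (x k w)))\<^sup>2 \<partial>M)
        = (\<integral>w. (norm (g k w - grad obj (x k w)))\<^sup>2 \<partial>M)"
      using g by (simp cong: Bochner_Integration.integral_cong)
    also have "\<dots> \<le> G"
      using F.real_cond_exp_int[OF V'] integral_le_const[OF _ A2(2)[OF that]] by simp
    finally have G: "(\<integral>w. (norm (avg_grad f (NN k w) (x k w) - grad obj (x k w)))\<^sup>2 \<partial>M) \<le> G" .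
    have "(norm (u + v))\<^sup>2 \<le> 2 * (norm u)\<^sup>2 + 2 * (norm v)\<^sup>2" for u v :: "real ^ 'n"
      using sum_squares_bound[of "norm u" "norm v"] norm_triangle_ineq[of u v]
        power_mono[of "norm (u + v)" "norm u + norm v" 2] by (simp add: power2_sum)
    from this[of "avg_grad f (NN k w) (x k w) - grad obj (x k w)" "grad obj (x k w)" for w]
    have "(\<integral>w. (norm (avg_grad f (NN k w) (x k w)))\<^sup>2 \<partial>M)
        \<le> (\<integral>w. 2 * (norm (avg_grad f (NN k w) (x k w) - grad obj (x k w)))\<^sup>2
              + 2 * (norm (grad obj (x k w)))\<^sup>2 \<partial>M)"
      using V integrable_g2 integrable_H2 by (intro integral_mono) auto
    also have "\<dots> = 2 * (\<integral>w. (norm (avg_grad f (NN k w) (x k w) - grad obj (x k w)))\<^sup>2 \<partial>M) + 2 * n k"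
      using V integrable_H2 by (simp add: n_def)
    finally show ?thesis
      using G by simp
  qed

  have mean_pos_part: "(\<integral>w. max 0 (X k w) \<partial>M) \<le> \<theta> / real s * n k + C / (real s * real k powr \<delta>)"
    if "m dvd k" "k \<ge> 1" for k
  proof -
    have B: "B k \<in> sets M"
      using borel_measurable_integrable[OF integrable_X] unfolding B_def obj_def[symmetric] X_def[symmetric]
      by measurable
    note cexp = integral_cprob_cexp_event[OF finite_measure_axioms subalg B integrable_X, of k k, unfolded X_def]
    have "(\<integral>w. max 0 (X k w) \<partial>M) = (\<integral>w. X k w * indicator (B k) w \<partial>M)"
      by (intro Bochner_Integration.integral_cong) (auto simp: B_def X_def obj_def indicator_def)
    also have "\<dots> \<le> (\<integral>w. (\<theta> / real s) * (norm (grad obj (x k w)))\<^sup>2 + C / (real s * real k powr \<delta>) \<partial>M)"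
      unfolding X_def cexp(2)[symmetric]
      using cexp(1) A3(5)[OF that(2,1)] integrable_H2 by (intro integral_mono_AE) auto
    also have "\<dots> = \<theta> / real s * n k + C / (real s * real k powr \<delta>)"
      using integrable_H2 by (simp add: n_def prob_space)
    finally show ?thesis .
  qed

  define K where "K = L * (real m * (1 + L * \<gamma>max) ^ m)\<^sup>2"
  define a where "a k = (\<integral>w. obj (x k w) \<partial>M)" for k
  have "K \<ge> 0"
    using L by (simp add: K_def)
  have cycle: "a (k + m) \<le> a k - \<gamma>max * r * n k
      + (\<gamma>max - \<gamma>min) * r * (\<theta> / real s * n k + C / (real s * real k powr \<delta>))
      + K * (\<gamma>max / real k)\<^sup>2 * (n k + (2 * n k + 2 * G))"
    if k: "m dvd k" "k \<ge> 1" "L * \<gamma>max \<le> 2 * (1 - \<eta>) * real k" and r: "r = (\<Sum>i<m. 1 / real (k + i))"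
    for k r
  proof -
    have "r \<ge> 0"
      unfolding r by (intro sum_nonneg) auto
    have "a (k + m) \<le> (\<integral>w. obj (x k w) - \<gamma>max * r * X k w + (\<gamma>max - \<gamma>min) * r * max 0 (X k w)
        + K * (\<gamma>max / real k)\<^sup>2 * ((norm (grad obj (x k w)))\<^sup>2 + (norm (avg_grad f (NN k w) (x k w)))\<^sup>2) \<partial>M)"
      unfolding a_def
    proof (rule integral_mono)
      fix w assume w: "w \<in> space M"
      show "obj (x (k + m) w) \<le> obj (x k w) - \<gamma>max * r * X k w + (\<gamma>max - \<gamma>min) * r * max 0 (X k w)
        + K * (\<gamma>max / real k)\<^sup>2 * ((norm (grad obj (x k w)))\<^sup>2 + (norm (avg_grad f (NN k w) (x k w)))\<^sup>2)"
        using slises_run_cycle_descent[OF run[OF w] \<open>S \<in> {1..N}\<close> k(1,2) \<open>m \<ge> 1\<close> \<gamma> \<open>\<And>k. t k \<ge> 0\<close>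
            GDERIV lipschitz k(3) \<open>\<eta> < 1\<close>]
        unfolding obj_def[symmetric] grad_obj X_def K_def r g[OF w] .
    qed (use integrable_x integrable_X integrable_H2 integrable_g2 in auto)
    also have "\<dots> = a k - \<gamma>max * r * (\<integral>w. X k w \<partial>M) + (\<gamma>max - \<gamma>min) * r * (\<integral>w. max 0 (X k w) \<partial>M)
        + K * (\<gamma>max / real k)\<^sup>2 * (n k + (\<integral>w. (norm (avg_grad f (NN k w) (x k w)))\<^sup>2 \<partial>M))"
      using integrable_x integrable_X integrable_H2 integrable_g2 by (simp add: a_def n_def)
    also have "\<dots> \<le> a k - \<gamma>max * r * n k
        + (\<gamma>max - \<gamma>min) * r * (\<theta> / real s * n k + C / (real s * real k powr \<delta>))
        + K * (\<gamma>max / real k)\<^sup>2 * (n k + (2 * n k + 2 * G))"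
      unfolding mean_X[OF k(1)] using \<gamma> \<open>r \<ge> 0\<close> \<open>K \<ge> 0\<close> mean_pos_part[OF k(1,2)] mean_g2[OF k(1)]
      by (intro add_mono mult_left_mono order_refl) auto
    finally show ?thesis .
  qed

  obtain l where l: "\<And>y. l \<le> obj y"
    using avg_obj_bounded_below[of "{1..N}" f] A1(1) unfolding obj_def by blast
  have "summable (\<lambda>j. n (j * m) / real j)"
  proof (rule summable_cycle_recursion[where a = "\<lambda>j. a (j * m)" and n = "\<lambda>j. n (j * m)"
        and \<gamma>min = \<gamma>min and \<gamma>max = \<gamma>max and l = l and s = s and G = G and K = K and C = C and \<theta> = \<theta> and \<delta> = \<delta> and m = m and J = "nat \<lceil>L * \<gamma>max / (2 * (1 - \<eta>))\<rceil>"])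
    show "l \<le> a (j * m)" for j
      unfolding a_def using l integrable_x by (intro integral_ge_const) auto
    fix j assume j: "j \<ge> nat \<lceil>L * \<gamma>max / (2 * (1 - \<eta>))\<rceil>" "j \<ge> 1"
    have "L * \<gamma>max \<le> 2 * (1 - \<eta>) * real j"
      using j \<open>\<eta> < 1\<close> by (simp add: nat_ceiling_le_eq field_simps)
    also have "\<dots> \<le> 2 * (1 - \<eta>) * real (j * m)"
      using \<open>\<eta> < 1\<close> \<open>m \<ge> 1\<close> by (intro mult_left_mono) (auto simp del: of_nat_mult)
    finally show "a (Suc j * m) \<le> a (j * m) - \<gamma>max * (\<Sum>i<m. 1 / real (j * m + i)) * n (j * m)
        + (\<gamma>max - \<gamma>min) * (\<Sum>i<m. 1 / real (j * m + i))
          * (\<theta> / real s * n (j * m) + C / (real s * real (j * m) powr \<delta>))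
        + K * (\<gamma>max / real (j * m))\<^sup>2 * (n (j * m) + (2 * n (j * m) + 2 * G))"
      using cycle[of "j * m", OF _ _ _ refl] j \<open>m \<ge> 1\<close> by (simp add: add.commute)
  qed (use \<open>m \<ge> 1\<close> \<gamma> A3 A2(1) \<open>real s \<ge> \<theta>\<close> s \<open>K \<ge> 0\<close> n_nonneg in auto)
  then have "AE w in M. summable (\<lambda>j. (norm (grad obj (x (j * m) w)))\<^sup>2 / real j)"
    using integrable_H2 by (intro AE_summable_if_summable_integral) (auto simp: n_def)
  then show ?thesis
  proof (rule eventually_mono)
    fix w assume sum: "summable (\<lambda>j. (norm (grad obj (x (j * m) w)))\<^sup>2 / real j)"
    show "liminf (\<lambda>k. ereal (norm (grad obj (x k w)))) = 0"
    proof (rule liminf_eq_0_along_subsequence[OF _ \<open>m \<ge> 1\<close>])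
      fix \<epsilon> :: real assume "\<epsilon> > 0"
      then have "\<exists>\<^sub>F j in sequentially. (norm (grad obj (x (j * m) w)))\<^sup>2 < \<epsilon>\<^sup>2"
        by (intro frequently_small_if_summable_divide_index[OF sum]) simp
      then show "\<exists>\<^sub>F j in sequentially. norm (grad obj (x (j * m) w)) < \<epsilon>"
        by (rule frequently_elim1) (use \<open>\<epsilon> > 0\<close> in \<open>auto intro: power_less_imp_less_base\<close>)
    qed simp
  qed
qed

end
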